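(* Let $\{F_\varsigma\}_{\varsigma\in\mathfrak{A}}$ be a $V$-controlled integral frame, where $V$ is an invertible operator on $\mathcal{H}^N$. Then the following statements are equivalent: (1) $\{F_\varsigma\}_{\varsigma\in\mathfrak{A}}$ is a $V$-controlled integral frame with bounds $A$ and $B$; (2) $S_{VF}(f)=\int_{\mathfrak{A}}\langle f,F_\varsigma\rangle VF_\varsigma\,d\mu(\varsigma)$ is an invertible and positive operator on $\mathcal{H}^N$.
   Context: $(\mathfrak{A},\mu)$ is a measure space with positive measure $\mu$, and $\mathcal{H}^N$ is an $N$-dimensional Hilbert space. For an invertible operator $V$ on $\mathcal{H}^N$, a family $\{F_\varsigma\}_{\varsigma\in\mathfrak{A}}$ in $\mathcal{H}^N$ is called a $V$-controlled integral frame if there exist $0<A\le B<\infty$ such that $A\|f\|^2\le\int_{\mathfrak{A}}\langle f,F_\varsigma\rangle\langle VF_\varsigma,f\rangle\,d\mu(\varsigma)\le B\|f\|^2$ for all $f\in\mathcal{H}^N$; the numbers $A$ and $B$ are called the $V$-controlled integral frame bounds. The operator $S_{VF}$, called the controlled integral frame operator, is understood in the weak sense. *)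

theory Defs
  imports "HOL-Analysis.Analysis" "HOL-Library.Complex_Order"
begin

text \<open>
  A complex Hilbert space of dimension \<open>N\<close>, with underlying set the whole type \<open>'a\<close>. The inner
  product \<open>ip f g\<close> is linear in \<open>f\<close> and conjugate-linear in \<open>g\<close>. Completeness is automatic in
  finite dimension and therefore not an axiom. Inequalities between complex numbers refer to the
  order of \<^theory>\<open>HOL-Library.Complex_Order\<close>: \<open>0 \<le> z\<close> means that \<open>z\<close> is real and nonnegative.
\<close>
locale fin_dim_hilbert = vector_space sc
  for sc :: "complex \<Rightarrow> 'a::ab_group_add \<Rightarrow> 'a" +
  fixes ip :: "'a \<Rightarrow> 'a \<Rightarrow> complex" and N :: nat
  assumes ip_add_left: "ip (f + g) h = ip f h + ip g h"
    and ip_scale_left: "ip (sc c f) g = c * ip f g"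
    and ip_commute: "ip f g = cnj (ip g f)"
    and ip_nonneg: "0 \<le> ip f f"
    and ip_definite: "ip f f = 0 \<Longrightarrow> f = 0"
    and basis: "\<exists>B. finite B \<and> card B = N \<and> independent B \<and> span B = UNIV"

definition ip_norm :: "('a \<Rightarrow> 'a \<Rightarrow> complex) \<Rightarrow> 'a \<Rightarrow> real" where
  "ip_norm ip f = sqrt (Re (ip f f))"

definition invertible_operator ::
    "(complex \<Rightarrow> 'a::ab_group_add \<Rightarrow> 'a) \<Rightarrow> ('a \<Rightarrow> 'a) \<Rightarrow> bool" where
  "invertible_operator sc T \<longleftrightarrow> Vector_Spaces.linear sc sc T \<and> bij T"

definition positive_operator ::
    "(complex \<Rightarrow> 'a::ab_group_add \<Rightarrow> 'a) \<Rightarrow> ('a \<Rightarrow> 'a \<Rightarrow> complex) \<Rightarrow> ('a \<Rightarrow> 'a) \<Rightarrow> bool" where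
  "positive_operator sc ip T \<longleftrightarrow>
     Vector_Spaces.linear sc sc T \<and> (\<forall>f. 0 \<le> ip (T f) f)"

text \<open>
  The Bochner integral of a non-integrable function is \<open>0\<close> by convention, so the existence of the
  integrals is part of the definition. The chain of inequalities is between complex numbers and
  so includes that the integral is real.
\<close>
definition controlled_integral_frame_with_bounds ::
    "('a \<Rightarrow> 'a \<Rightarrow> complex) \<Rightarrow> 'b measure \<Rightarrow> ('a \<Rightarrow> 'a) \<Rightarrow> ('b \<Rightarrow> 'a) \<Rightarrow> real \<Rightarrow> real \<Rightarrow> bool" where
  "controlled_integral_frame_with_bounds ip M V F A B \<longleftrightarrow>
     0 < A \<and> A \<le> B \<and>
     (\<forall>f. integrable M (\<lambda>s. ip f (F s) * ip (V (F s)) f) \<and>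
          complex_of_real (A * (ip_norm ip f)\<^sup>2) \<le> (LINT s|M. ip f (F s) * ip (V (F s)) f) \<and>
          (LINT s|M. ip f (F s) * ip (V (F s)) f) \<le> complex_of_real (B * (ip_norm ip f)\<^sup>2))"

definition controlled_integral_frame ::
    "('a \<Rightarrow> 'a \<Rightarrow> complex) \<Rightarrow> 'b measure \<Rightarrow> ('a \<Rightarrow> 'a) \<Rightarrow> ('b \<Rightarrow> 'a) \<Rightarrow> bool" where
  "controlled_integral_frame ip M V F \<longleftrightarrow>
     (\<exists>A B. controlled_integral_frame_with_bounds ip M V F A B)"

text \<open>
  The vector-valued integral defining \<open>S f\<close> is taken in the weak sense: \<open>S f\<close> is the vector that
  represents the functional given by the scalar integrals of \<open>\<langle>f, F s\<rangle> \<langle>V (F s), g\<rangle>\<close>. It exists and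
  is unique whenever these integrals exist for all \<open>f\<close> and \<open>g\<close>; for a controlled integral frame
  they do, by polarization.
\<close>
definition weakly_integrable ::
    "('a \<Rightarrow> 'a \<Rightarrow> complex) \<Rightarrow> 'b measure \<Rightarrow> ('a \<Rightarrow> 'a) \<Rightarrow> ('b \<Rightarrow> 'a) \<Rightarrow> bool" where
  "weakly_integrable ip M V F \<longleftrightarrow>
     (\<forall>f g. integrable M (\<lambda>s. ip f (F s) * ip (V (F s)) g))"

definition controlled_frame_operator ::
    "('a \<Rightarrow> 'a \<Rightarrow> complex) \<Rightarrow> 'b measure \<Rightarrow> ('a \<Rightarrow> 'a) \<Rightarrow> ('b \<Rightarrow> 'a) \<Rightarrow> 'a \<Rightarrow> 'a" where
  "controlled_frame_operator ip M V F f =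
     (THE h. \<forall>g. ip h g = (LINT s|M. ip f (F s) * ip (V (F s)) g))"

end

theory Submission
  imports Defs
begin

text \<open>
  Both directions compare the two quadratic forms \<open>\<langle>f, f\<rangle>\<close> and \<open>\<langle>S f, f\<rangle>\<close>, where \<open>S\<close> is the
  controlled frame operator: by the weak definition of \<open>S\<close>, the integral in the frame condition is
  \<open>\<langle>S f, f\<rangle>\<close>, so the frame condition says exactly that
  \<open>A \<parallel>f\<parallel>\<^sup>2 \<le> \<langle>S f, f\<rangle> \<le> B \<parallel>f\<parallel>\<^sup>2\<close>.

  The vector \<open>S f\<close> exists because every conjugate-linear functional on the space is represented by
  a vector (\<open>riesz_representation\<close>). For this the integrals of \<open>\<langle>f, F s\<rangle> \<langle>V (F s), g\<rangle>\<close> have to exist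
  for all \<open>f\<close> and \<open>g\<close>; the frame condition gives this on the diagonal \<open>f = g\<close> only, and polarization
  extends it (\<open>controlled_integral_frame_imp_weakly_integrable\<close>).

  From a lower frame bound, \<open>\<langle>S f, f\<rangle>\<close> vanishes only for \<open>f = 0\<close>; so \<open>S\<close> is injective, hence
  bijective in finite dimension, and it is positive because the integrals are.

  Conversely, if \<open>S\<close> is positive and invertible then \<open>\<langle>S f, g\<rangle>\<close> is again an inner product
  (\<open>inner_product_of_positive_operator\<close>). Any two inner products on a finite-dimensional space
  dominate each other up to a constant (\<open>inner_product_dominated\<close>), and the two constants are the
  frame bounds. Both finite-dimensional facts are proved by adding one orthogonal direction
  at a time (\<open>orthogonal_induct\<close>).
\<close>

section \<open>Finite-dimensional inner product spaces\<close>

context fin_dim_hilbert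
begin

lemma ip_add_right: "ip f (g + h) = ip f g + ip f h"
  by (metis complex_cnj_add ip_add_left ip_commute)

lemma ip_scale_right: "ip f (sc c g) = cnj c * ip f g"
  by (metis complex_cnj_mult ip_commute ip_scale_left)

lemma ip_zero_left [simp]: "ip 0 g = 0"
  using ip_add_left[of 0 0 g] by simp

lemma ip_zero_right [simp]: "ip f 0 = 0"
  using ip_add_right[of f 0 0] by simp

lemma ip_diff_left: "ip (f - g) h = ip f h - ip g h"
  using ip_add_left[of "f - g" g h] by (simp add: algebra_simps)

lemma ip_diff_right: "ip f (g - h) = ip f g - ip f h"
  using ip_add_right[of f "g - h" h] by (simp add: algebra_simps)

lemmas ip_expand = ip_add_left ip_add_right ip_scale_left ip_scale_right ip_diff_left ip_diff_right

lemma ip_eqI: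
  assumes "\<And>g. ip f g = ip h g"
  shows "f = h"
  using ip_definite[of "f - h"] assms by (simp add: ip_diff_left)

lemma ip_norm_square: "complex_of_real ((ip_norm ip f)\<^sup>2) = ip f f"
  using ip_nonneg[of f] by (simp add: ip_norm_def complex_eq_iff less_eq_complex_def)

lemma orthogonal_projection_exists:
  assumes "finite B"
  shows "\<exists>p \<in> span B. \<forall>x \<in> span B. ip (f - p) x = 0"
  using assms
proof (induction B arbitrary: f)
  case empty
  then show ?case by simp
next
  case (insert b B)
  obtain q where q: "q \<in> span B" "\<And>x. x \<in> span B \<Longrightarrow> ip (b - q) x = 0"
    using insert.IH by blast
  obtain p where p: "p \<in> span B" "\<And>x. x \<in> span B \<Longrightarrow> ip (f - p) x = 0"
    using insert.IH by blast
  define e where "e = b - q"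
  have eB: "ip e x = 0" if "x \<in> span B" for x
    using q(2) that by (simp add: e_def)
  have eB': "ip x e = 0" if "x \<in> span B" for x
    using eB[OF that] ip_commute[of x e] by simp
  \<comment> \<open>If \<open>b\<close> already lies in \<open>span B\<close>, then \<open>e = 0\<close> and the quotient is \<open>0\<close>, as it should be.\<close>
  define c where "c = ip f e / ip e e"
  have e_span: "e \<in> span (insert b B)"
    unfolding e_def using q(1) by (meson insertI1 span_base span_diff span_mono subset_iff subset_insertI)
  have p_span: "p \<in> span (insert b B)"
    using p(1) by (meson span_mono subset_iff subset_insertI)
  have fe: "ip (f - (p + sc c e)) e = 0"
  proof (cases "e = 0")
    case False
    then have "ip e e \<noteq> 0" using ip_definite by blast
    then show ?thesis by (simp add: ip_expand c_def eB' p(1))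
  qed simp
  have "ip (f - (p + sc c e)) x = 0" if "x \<in> span (insert b B)" for x
  proof -
    obtain k where k: "x - sc k b \<in> span B"
      using \<open>x \<in> span (insert b B)\<close> by (auto simp: span_insert)
    define y where "y = x - sc k e"
    have "y = (x - sc k b) + sc k q"
      by (simp add: y_def e_def scale_right_diff_distrib)
    then have y: "y \<in> span B" using k q(1) by (simp add: span_add span_scale)
    have x: "x = sc k e + y" by (simp add: y_def)
    have "ip (f - (p + sc c e)) y = 0"
      using p(2)[OF y] eB[OF y] by (simp add: ip_expand)
    then show ?thesis using fe by (simp add: x ip_add_right ip_scale_right)
  qed
  moreover have "p + sc c e \<in> span (insert b B)"
    using p_span e_span by (simp add: span_add span_scale)
  ultimately show ?case by blast
qed

text \<open>
  This is Gram--Schmidt as an induction rule: an orthogonal basis is never named, only the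
  extension of a subset \<open>W\<close> by one direction orthogonal to it.
\<close>
lemma orthogonal_induct [case_names zero extend]:
  assumes zero: "P {0}"
    and extend: "\<And>W e. P W \<Longrightarrow> e \<noteq> 0 \<Longrightarrow> (\<And>w. w \<in> W \<Longrightarrow> ip e w = 0) \<Longrightarrow>
      P {sc c e + w |c w. w \<in> W}"
  shows "P UNIV"
proof -
  have "P (span B)" if "finite B" for B
    using that
  proof (induction B)
    case empty
    then show ?case by (simp add: zero)
  next
    case (insert b B)
    obtain q where q: "q \<in> span B" "\<And>x. x \<in> span B \<Longrightarrow> ip (b - q) x = 0"
      using orthogonal_projection_exists[OF insert.hyps(1)] by blast
    show ?case
    proof (cases "b = q")
      case True
      then show ?thesis using insert.IH q(1) by (simp add: span_redundant)
    next
      case False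
      have "span (insert b B) = {sc c (b - q) + w |c w. w \<in> span B}"
      proof (intro equalityI subsetI)
        fix x assume "x \<in> span (insert b B)"
        then obtain k where k: "x - sc k b \<in> span B" by (auto simp: span_insert)
        have "x = sc k (b - q) + ((x - sc k b) + sc k q)"
          by (simp add: scale_right_diff_distrib)
        moreover have "(x - sc k b) + sc k q \<in> span B"
          using k q(1) by (simp add: span_add span_scale)
        ultimately show "x \<in> {sc c (b - q) + w |c w. w \<in> span B}" by blast
      next
        fix x assume "x \<in> {sc c (b - q) + w |c w. w \<in> span B}"
        then obtain c w where x: "x = sc c (b - q) + w" "w \<in> span B" by blast
        have "x - sc c b = w - sc c q" by (simp add: x(1) scale_right_diff_distrib)
        then have "x - sc c b \<in> span B" using x(2) q(1) by (simp add: span_diff span_scale)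
        then show "x \<in> span (insert b B)" by (auto simp: span_insert)
      qed
      moreover have "P {sc c (b - q) + w |c w. w \<in> span B}"
        using False q(2) by (intro extend insert.IH) auto
      ultimately show ?thesis by simp
    qed
  qed
  then show ?thesis using basis by metis
qed

text \<open>
  When a direction \<open>e\<close> orthogonal to \<open>W\<close> is added, a multiple of \<open>e\<close> added to the representing
  vector corrects its value at \<open>e\<close> without changing its values on \<open>W\<close>.
\<close>
lemma riesz_representation:
  assumes add: "\<And>f g. \<phi> (f + g) = \<phi> f + \<phi> g"
    and scale: "\<And>c f. \<phi> (sc c f) = cnj c * \<phi> f"
  shows "\<exists>h. \<forall>g. ip h g = \<phi> g"
proof -
  have "\<exists>h. \<forall>g \<in> UNIV. ip h g = \<phi> g"
  proof (induction rule: orthogonal_induct)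
    case zero
    show ?case using scale[of 0 0] by simp
  next
    case (extend W e)
    obtain h where h: "\<And>w. w \<in> W \<Longrightarrow> ip h w = \<phi> w" using extend.IH by blast
    have ee: "ip e e \<noteq> 0" using extend.hyps(1) ip_definite by blast
    define h' where "h' = h + sc ((\<phi> e - ip h e) / ip e e) e"
    have "ip h' e = \<phi> e" using ee by (simp add: h'_def ip_expand)
    moreover have "ip h' w = \<phi> w" if "w \<in> W" for w
      using h[OF that] extend.hyps(2)[OF that] by (simp add: h'_def ip_expand)
    ultimately have "\<forall>g \<in> {sc c e + w |c w. w \<in> W}. ip h' g = \<phi> g"
      by (auto simp: ip_add_right ip_scale_right add scale)
    then show ?case by blast
  qed
  then show ?thesis by simp
qed

text \<open>
  The proof uses the parallelogram bound \<open>Q (f + g) \<le> 2 Q f + 2 Q g\<close> for the dominated form, and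
  Pythagoras \<open>\<parallel>c e + w\<parallel>\<^sup>2 = \<bar>c\<bar>\<^sup>2 \<parallel>e\<parallel>\<^sup>2 + \<parallel>w\<parallel>\<^sup>2\<close> for the dominating one.
\<close>
lemma inner_product_dominated:
  assumes "fin_dim_hilbert sc ip' N'"
  shows "\<exists>K > 0. \<forall>f. (ip_norm ip' f)\<^sup>2 \<le> K * (ip_norm ip f)\<^sup>2"
proof -
  interpret Q: fin_dim_hilbert sc ip' N' by (rule assms)
  have norm2: "(ip_norm ip f)\<^sup>2 = Re (ip f f)" for f
    using ip_norm_square[of f] by (metis Re_complex_of_real)
  have Qnorm2: "(ip_norm ip' f)\<^sup>2 = Re (ip' f f)" for f
    using Q.ip_norm_square[of f] by (metis Re_complex_of_real)
  have Q0: "Re (ip' f f) \<ge> 0" for f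
    using Q.ip_nonneg[of f] by (simp add: less_eq_complex_def)
  have P0: "Re (ip f f) \<ge> 0" for f
    using ip_nonneg[of f] by (simp add: less_eq_complex_def)
  have par: "Re (ip' (f + g) (f + g)) \<le> 2 * Re (ip' f f) + 2 * Re (ip' g g)" for f g
    using Q0[of "f - g"] by (simp add: Q.ip_expand)
  have Qscale: "Re (ip' (sc c f) (sc c f)) = (cmod c)\<^sup>2 * Re (ip' f f)" for c f
    by (simp add: Q.ip_expand cmod_power2) (simp add: algebra_simps power2_eq_square)
  have "\<exists>K > 0. \<forall>f \<in> UNIV. Re (ip' f f) \<le> K * Re (ip f f)"
  proof (induction rule: orthogonal_induct)
    case zero
    show ?case by (auto intro: exI[of _ 1])
  next
    case (extend W e)
    obtain K where K: "K > 0" "\<And>w. w \<in> W \<Longrightarrow> Re (ip' w w) \<le> K * Re (ip w w)"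
      using extend.IH by blast
    define a where "a = Re (ip e e)"
    define b where "b = Re (ip' e e)"
    have "ip e e \<noteq> 0" using extend.hyps(1) ip_definite by blast
    then have a: "a > 0"
      using ip_nonneg[of e] by (auto simp: a_def less_eq_complex_def complex_eq_iff)
    have b: "b \<ge> 0" using Q0 by (simp add: b_def)
    define K' where "K' = 2 * b / a + 2 * K"
    have K': "K' > 0" using a b K(1) by (simp add: K'_def add_nonneg_pos)
    have "Re (ip' (sc c e + w) (sc c e + w)) \<le> K' * Re (ip (sc c e + w) (sc c e + w))"
      if w: "w \<in> W" for c w
    proof -
      have "ip w e = 0" using extend.hyps(2)[OF w] ip_commute[of w e] by simp
      then have pyth: "Re (ip (sc c e + w) (sc c e + w)) = (cmod c)\<^sup>2 * a + Re (ip w w)"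
        using extend.hyps(2)[OF w] unfolding a_def
        by (simp add: ip_expand cmod_power2) (simp add: algebra_simps power2_eq_square)
      have "Re (ip' (sc c e + w) (sc c e + w)) \<le> 2 * ((cmod c)\<^sup>2 * b) + 2 * (K * Re (ip w w))"
        using par[of "sc c e" w] K(2)[OF w] by (simp add: Qscale b_def)
      also have "2 * ((cmod c)\<^sup>2 * b) = 2 * b / a * ((cmod c)\<^sup>2 * a)"
        using a by simp
      also have "\<dots> + 2 * (K * Re (ip w w)) \<le> K' * ((cmod c)\<^sup>2 * a) + K' * Re (ip w w)"
        using a b K(1) P0[of w]
        by (intro add_mono) (auto simp: K'_def distrib_right)
      finally show ?thesis by (simp add: pyth distrib_left)
    qed
    then show ?case using K' by blast
  qed
  then show ?thesis by (simp add: norm2 Qnorm2)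
qed

section \<open>Positive operators\<close>

text \<open>
  On a complex space, self-adjointness is a consequence of positivity: it follows from the reality
  of \<open>\<langle>T h, h\<rangle>\<close> for \<open>h = f + g\<close> and \<open>h = f + i g\<close>.
\<close>
lemma positive_operator_hermitian:
  assumes "positive_operator sc ip T"
  shows "ip (T f) g = cnj (ip (T g) f)"
proof -
  interpret T: Vector_Spaces.linear sc sc T using assms by (simp add: positive_operator_def)
  have real: "Im (ip (T h) h) = 0" for h
    using assms by (simp add: positive_operator_def less_eq_complex_def)
  have "Im (ip (T f) g) + Im (ip (T g) f) = 0"
    using real[of "f + g"] real[of f] real[of g] by (simp add: T.add ip_expand)
  moreover have "Re (ip (T g) f) - Re (ip (T f) g) = 0"
    using real[of "f + sc \<i> g"] real[of f] real[of g] by (simp add: T.add T.scale ip_expand)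
  ultimately show ?thesis by (simp add: complex_eq_iff)
qed

text \<open>
  This is the degenerate case of the Cauchy--Schwarz inequality for the semidefinite form
  \<open>\<langle>T f, g\<rangle>\<close>, applied to \<open>f\<close> and \<open>g = T f\<close>: along the line \<open>T f - r f\<close> the quadratic form
  decreases linearly in \<open>r\<close> at the rate \<open>2 \<parallel>T f\<parallel>\<^sup>2\<close>, so it would become negative unless
  \<open>T f = 0\<close>.
\<close>
lemma positive_operator_kernel:
  assumes pos: "positive_operator sc ip T"
    and "ip (T f) f = 0"
  shows "T f = 0"
proof (rule ccontr)
  assume "T f \<noteq> 0"
  interpret T: Vector_Spaces.linear sc sc T using pos by (simp add: positive_operator_def)
  define a where "a = Re (ip (T f) (T f))"
  define b where "b = Re (ip (T (T f)) (T f))"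
  have "ip (T f) (T f) \<noteq> 0" using \<open>T f \<noteq> 0\<close> ip_definite by blast
  then have a: "a > 0"
    using ip_nonneg[of "T f"] by (auto simp: a_def less_eq_complex_def complex_eq_iff)
  have TT: "Re (ip (T (T f)) f) = a"
    using positive_operator_hermitian[OF pos, of "T f" f] by (simp add: a_def)
  have slope: "0 \<le> b - 2 * r * a" for r
  proof -
    have "0 \<le> Re (ip (T (T f - sc (complex_of_real r) f)) (T f - sc (complex_of_real r) f))"
      using pos by (simp add: positive_operator_def less_eq_complex_def)
    also have "\<dots> = b - 2 * r * a"
      using assms(2) TT by (simp add: T.diff T.scale ip_expand a_def b_def)
    finally show ?thesis .
  qed
  show False using slope[of "(b + 1) / (2 * a)"] a by simp
qed

lemma inner_product_of_positive_operator:
  assumes inv: "invertible_operator sc T" and pos: "positive_operator sc ip T"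
  shows "fin_dim_hilbert sc (\<lambda>f g. ip (T f) g) N"
proof -
  interpret T: Vector_Spaces.linear sc sc T using pos by (simp add: positive_operator_def)
  have "f = 0" if "ip (T f) f = 0" for f
  proof -
    have "T f = T 0" using positive_operator_kernel[OF pos that] by (simp add: T.zero)
    then show ?thesis using inv by (metis bij_is_inj injD invertible_operator_def)
  qed
  then show ?thesis
  proof unfold_locales
    show "ip (T f) g = cnj (ip (T g) f)" for f g
      by (rule positive_operator_hermitian[OF pos])
    show "\<exists>B. finite B \<and> card B = N \<and> independent B \<and> span B = UNIV"
      by (rule basis)
  qed (use pos in \<open>simp_all add: T.add T.scale ip_add_left ip_scale_left positive_operator_def\<close>)
qed

lemma invertible_operator_if_definite:
  assumes lin: "Vector_Spaces.linear sc sc T"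
    and definite: "\<And>f. ip (T f) f = 0 \<Longrightarrow> f = 0"
  shows "invertible_operator sc T"
proof -
  interpret T: Vector_Spaces.linear sc sc T by (rule lin)
  obtain B where B: "finite B" "independent B" "span B = UNIV" using basis by blast
  interpret fd: finite_dimensional_vector_space sc B
    using B by unfold_locales auto
  have inj: "inj T" using definite by (auto simp: T.inj_iff_eq_0)
  have "surj T" by (rule fd.linear_inj_imp_surj[OF lin inj])
  with inj show ?thesis using lin by (simp add: invertible_operator_def bij_def)
qed

section \<open>The controlled frame operator\<close>

text \<open>
  For each \<open>s\<close> the integrand is linear in \<open>f\<close> and conjugate-linear in \<open>g\<close>, so it is a combination
  of its diagonal values at \<open>f + i\<^sup>k g\<close>, which are integrable.
\<close>
lemma controlled_integral_frame_imp_weakly_integrable: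
  assumes "controlled_integral_frame ip M V F"
  shows "weakly_integrable ip M V F"
  unfolding weakly_integrable_def
proof (intro allI)
  fix f g
  define q where "q h = (\<lambda>s. ip h (F s) * ip (V (F s)) h)" for h
  have int: "integrable M (q h)" for h
    using assms
    by (auto simp: q_def controlled_integral_frame_def controlled_integral_frame_with_bounds_def)
  have polarization: "ip f (F s) * ip (V (F s)) g =
      (q (f + g) s - q (f - g) s + \<i> * (q (f + sc \<i> g) s - q (f - sc \<i> g) s)) / 4" for s
    by (simp add: q_def ip_expand field_simps)
  show "integrable M (\<lambda>s. ip f (F s) * ip (V (F s)) g)"
    unfolding polarization
    by (intro integrable_divide_zero Bochner_Integration.integrable_add
        Bochner_Integration.integrable_diff integrable_mult_right int)
qed

lemma ip_controlled_frame_operator: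
  assumes "weakly_integrable ip M V F"
  shows "ip (controlled_frame_operator ip M V F f) g = (LINT s|M. ip f (F s) * ip (V (F s)) g)"
proof -
  have int: "integrable M (\<lambda>s. ip f (F s) * ip (V (F s)) g)" for f g
    using assms by (simp add: weakly_integrable_def)
  define \<phi> where "\<phi> g = (LINT s|M. ip f (F s) * ip (V (F s)) g)" for g
  have "\<phi> (g + h) = \<phi> g + \<phi> h" for g h
    by (simp add: \<phi>_def ip_add_right distrib_left int)
  moreover have "\<phi> (sc c g) = cnj c * \<phi> g" for c g
    by (simp add: \<phi>_def ip_scale_right mult.left_commute)
  ultimately obtain h where "\<forall>g. ip h g = \<phi> g"
    using riesz_representation[of \<phi>] by blast
  then have "\<exists>!h. \<forall>g. ip h g = \<phi> g"
    by (metis ip_eqI)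
  then have "\<forall>g. ip (controlled_frame_operator ip M V F f) g = \<phi> g"
    unfolding controlled_frame_operator_def \<phi>_def by (rule theI')
  then show ?thesis by (simp add: \<phi>_def)
qed

lemma linear_controlled_frame_operator:
  assumes "weakly_integrable ip M V F"
  shows "Vector_Spaces.linear sc sc (controlled_frame_operator ip M V F)"
proof -
  have int: "integrable M (\<lambda>s. ip f (F s) * ip (V (F s)) g)" for f g
    using assms by (simp add: weakly_integrable_def)
  note S = ip_controlled_frame_operator[OF assms]
  show ?thesis
  proof (unfold_locales)
    fix f g
    show "controlled_frame_operator ip M V F (f + g) =
        controlled_frame_operator ip M V F f + controlled_frame_operator ip M V F g"
      by (rule ip_eqI) (simp add: S ip_add_left distrib_right int)
  next
    fix c f
    show "controlled_frame_operator ip M V F (sc c f) = sc c (controlled_frame_operator ip M V F f)"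
      by (rule ip_eqI) (simp add: S ip_scale_left mult.assoc)
  qed
qed

lemma controlled_integral_frame_with_bounds_iff:
  assumes "weakly_integrable ip M V F"
  shows "controlled_integral_frame_with_bounds ip M V F A B \<longleftrightarrow> 0 < A \<and> A \<le> B \<and>
    (\<forall>f. complex_of_real (A * (ip_norm ip f)\<^sup>2) \<le> ip (controlled_frame_operator ip M V F f) f \<and>
      ip (controlled_frame_operator ip M V F f) f \<le> complex_of_real (B * (ip_norm ip f)\<^sup>2))"
  using assms
  by (simp add: controlled_integral_frame_with_bounds_def ip_controlled_frame_operator[OF assms]
      weakly_integrable_def)

lemma controlled_frame_operator_of_frame:
  assumes weak: "weakly_integrable ip M V F"
    and frame: "controlled_integral_frame_with_bounds ip M V F A B"
  shows "invertible_operator sc (controlled_frame_operator ip M V F)"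
    and "positive_operator sc ip (controlled_frame_operator ip M V F)"
proof -
  let ?S = "controlled_frame_operator ip M V F"
  have A: "0 < A"
    and lower: "complex_of_real A * ip f f \<le> ip (?S f) f" for f
    using frame unfolding controlled_integral_frame_with_bounds_iff[OF weak]
    by (auto simp flip: ip_norm_square)
  have lin: "Vector_Spaces.linear sc sc ?S"
    by (rule linear_controlled_frame_operator[OF weak])
  have lower_nonneg: "0 \<le> complex_of_real A * ip f f" for f
    using A ip_nonneg[of f] by (simp add: less_eq_complex_def)
  have "f = 0" if "ip (?S f) f = 0" for f
  proof -
    have "complex_of_real A * ip f f = 0"
      using lower[of f] lower_nonneg[of f] that by (simp add: order_antisym)
    then show ?thesis using A ip_definite by simp
  qed
  then show "invertible_operator sc ?S"
    by (rule invertible_operator_if_definite[OF lin])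
  show "positive_operator sc ip ?S"
    using lin order_trans[OF lower_nonneg lower] by (simp add: positive_operator_def)
qed

lemma frame_of_controlled_frame_operator:
  assumes weak: "weakly_integrable ip M V F"
    and inv: "invertible_operator sc (controlled_frame_operator ip M V F)"
    and pos: "positive_operator sc ip (controlled_frame_operator ip M V F)"
  shows "\<exists>A B. controlled_integral_frame_with_bounds ip M V F A B"
proof -
  define p where "p = (\<lambda>f g. ip (controlled_frame_operator ip M V F f) g)"
  have hp: "fin_dim_hilbert sc p N"
    unfolding p_def by (rule inner_product_of_positive_operator[OF inv pos])
  interpret P: fin_dim_hilbert sc p N by (rule hp)
  obtain K where K: "K > 0" "\<And>f. (ip_norm p f)\<^sup>2 \<le> K * (ip_norm ip f)\<^sup>2"
    using inner_product_dominated[OF hp] by blast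
  obtain L where L: "L > 0" "\<And>f. (ip_norm ip f)\<^sup>2 \<le> L * (ip_norm p f)\<^sup>2"
    using P.inner_product_dominated[OF fin_dim_hilbert_axioms] by blast
  have lower: "1 / L * (ip_norm ip f)\<^sup>2 \<le> (ip_norm p f)\<^sup>2" for f
    using L(1) L(2)[of f] by (simp add: field_simps)
  \<comment> \<open>On the zero space \<open>K\<close> and \<open>L\<close> are unrelated, so \<open>1 / L \<le> K\<close> may fail; hence the maximum.\<close>
  have upper: "(ip_norm p f)\<^sup>2 \<le> max (1 / L) K * (ip_norm ip f)\<^sup>2" for f
    using K(2)[of f] by (rule order_trans) (simp add: mult_right_mono)
  have "controlled_integral_frame_with_bounds ip M V F (1 / L) (max (1 / L) K)"
    unfolding controlled_integral_frame_with_bounds_iff[OF weak]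
  proof (intro conjI allI)
    fix f
    have "ip (controlled_frame_operator ip M V F f) f = complex_of_real ((ip_norm p f)\<^sup>2)"
      using P.ip_norm_square[of f] by (simp add: p_def)
    then show "complex_of_real (1 / L * (ip_norm ip f)\<^sup>2)
          \<le> ip (controlled_frame_operator ip M V F f) f"
      and "ip (controlled_frame_operator ip M V F f) f
          \<le> complex_of_real (max (1 / L) K * (ip_norm ip f)\<^sup>2)"
      using lower[of f] upper[of f] by (simp_all only: less_eq_complex_def Re_complex_of_real Im_complex_of_real simp_thms)
  qed (use L(1) in auto)
  then show ?thesis by blast
qed

lemma frame_iff_invertible_positive:
  assumes "weakly_integrable ip M V F"
  shows "(\<exists>A B. controlled_integral_frame_with_bounds ip M V F A B) \<longleftrightarrow>
    invertible_operator sc (controlled_frame_operator ip M V F) \<and>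
    positive_operator sc ip (controlled_frame_operator ip M V F)"
  using controlled_frame_operator_of_frame[OF assms] frame_of_controlled_frame_operator[OF assms]
  by blast

end

theorem proposition2p4:
  fixes sc :: "complex \<Rightarrow> 'a::ab_group_add \<Rightarrow> 'a"
    and ip :: "'a \<Rightarrow> 'a \<Rightarrow> complex"
    and N :: nat
    and M :: "'b measure"
    and V :: "'a \<Rightarrow> 'a"
    and F :: "'b \<Rightarrow> 'a"
  assumes "fin_dim_hilbert sc ip N"
    and "invertible_operator sc V"
  shows "(controlled_integral_frame ip M V F \<longrightarrow>
            ((\<exists>A B. controlled_integral_frame_with_bounds ip M V F A B) \<longleftrightarrow>
             invertible_operator sc (controlled_frame_operator ip M V F) \<and>
             positive_operator sc ip (controlled_frame_operator ip M V F))) \<and>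
         (weakly_integrable ip M V F \<longrightarrow>
            ((\<exists>A B. controlled_integral_frame_with_bounds ip M V F A B) \<longleftrightarrow>
             invertible_operator sc (controlled_frame_operator ip M V F) \<and>
             positive_operator sc ip (controlled_frame_operator ip M V F)))"
proof -
  interpret fin_dim_hilbert sc ip N by (rule assms(1))
  show ?thesis
    using frame_iff_invertible_positive controlled_integral_frame_imp_weakly_integrable by blast
qed

end
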